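(* Let $H$ be a realizable 3-uniform hypergraph and let $T$ be a realization of $H$. Then $H$ is prime if and only if $T$ is prime.
   Context: All structures are finite. A 3-uniform hypergraph $H$ consists of a vertex set $V(H)$ and an edge set $E(H)\subseteq\binom{V(H)}{3}$. A tournament $T$ has a vertex set $V(T)$ and an arc set $A(T)$ such that for distinct $v,w\in V(T)$ exactly one of $vw,wv$ belongs to $A(T)$ (and there are no loops). A 3-cycle is a tournament on three vertices isomorphic to $(\{0,1,2\},\{01,12,20\})$. The $C_3$-structure $C_3(T)$ of a tournament $T$ is the 3-uniform hypergraph on $V(T)$ whose edges are the 3-element subsets $X$ of $V(T)$ such that $T[X]$ is a 3-cycle. A tournament $T$ with $V(T)=V(H)$ is a realization of $H$ if $H=C_3(T)$; $H$ is realizable if it admits a realization. A subset $M$ of $V(H)$ is a module of the hypergraph $H$ if for each $e\in E(H)$ such that $e\cap M\neq\emptyset$ and $e\setminus M\neq\emptyset$, there exists $m\in M$ such that $e\cap M=\{m\}$ and for every $n\in M$, $(e\setminus\{m\})\cup\{n\}\in E(H)$. A subset $M$ of $V(T)$ is a module of the tournament $T$ if for any $x,y\in M$ and $v\in V(T)$, if $xv,vy\in A(T)$, then $v\in M$. The empty set, the whole vertex set and the singletons are modules, called trivial. A hypergraph (resp. tournament) is prime if it has at least $3$ vertices and all its modules are trivial. *)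

theory Defs
  imports
    "Graph_Theory.Pair_Digraph"
    "Graph_Theory.Digraph_Isomorphism"
    "HOL-Library.Ramsey"
begin

record 'a hypergraph =
  hverts :: "'a set"
  hedges :: "'a set set"

locale three_uniform_hypergraph =
  fixes H :: "'a hypergraph"
  assumes finite_hverts: "finite (hverts H)"
    and hedges_subset: "hedges H \<subseteq> nsets (hverts H) 3"

locale tournament = pair_digraph G for G :: "'a pair_pre_digraph" +
  assumes exactly_one_arc:
    "\<lbrakk>v \<in> pverts G; w \<in> pverts G; v \<noteq> w\<rbrakk> \<Longrightarrow> ((v, w) \<in> parcs G) \<noteq> ((w, v) \<in> parcs G)"

definition cyclic_triangle :: "nat pair_pre_digraph" where
  "cyclic_triangle = \<lparr>pverts = {0, 1, 2}, parcs = {(0, 1), (1, 2), (2, 0)}\<rparr>"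

text \<open>A digraph isomorphic to \<^const>\<open>cyclic_triangle\<close> is automatically a tournament on three vertices.\<close>

definition is_3_cycle :: "('a, 'b) pre_digraph \<Rightarrow> bool" where
  "is_3_cycle G \<longleftrightarrow> digraph_iso G (with_proj cyclic_triangle)"

definition C3_structure :: "'a pair_pre_digraph \<Rightarrow> 'a hypergraph" where
  "C3_structure T = \<lparr>hverts = pverts T,
     hedges = {X \<in> nsets (pverts T) 3. is_3_cycle (with_proj T \<restriction> X)}\<rparr>"

definition realization :: "'a pair_pre_digraph \<Rightarrow> 'a hypergraph \<Rightarrow> bool" where
  "realization T H \<longleftrightarrow> tournament T \<and> pverts T = hverts H \<and> H = C3_structure T"

definition realizable :: "'a hypergraph \<Rightarrow> bool" where
  "realizable H \<longleftrightarrow> (\<exists>T. realization T H)"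

definition hypergraph_module :: "'a hypergraph \<Rightarrow> 'a set \<Rightarrow> bool" where
  "hypergraph_module H M \<longleftrightarrow> M \<subseteq> hverts H \<and>
     (\<forall>e \<in> hedges H. e \<inter> M \<noteq> {} \<and> e - M \<noteq> {} \<longrightarrow>
        (\<exists>m \<in> M. e \<inter> M = {m} \<and> (\<forall>n \<in> M. (e - {m}) \<union> {n} \<in> hedges H)))"

definition tournament_module :: "'a pair_pre_digraph \<Rightarrow> 'a set \<Rightarrow> bool" where
  "tournament_module T M \<longleftrightarrow> M \<subseteq> pverts T \<and>
     (\<forall>x \<in> M. \<forall>y \<in> M. \<forall>v \<in> pverts T. (x, v) \<in> parcs T \<and> (v, y) \<in> parcs T \<longrightarrow> v \<in> M)"

definition trivial_subset :: "'a set \<Rightarrow> 'a set \<Rightarrow> bool" where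
  "trivial_subset V M \<longleftrightarrow> M = {} \<or> M = V \<or> (\<exists>v \<in> V. M = {v})"

text \<open>Both notions of primality are meant for finite vertex sets, where \<^const>\<open>card\<close> is the
  actual number of vertices.\<close>

definition prime_hypergraph :: "'a hypergraph \<Rightarrow> bool" where
  "prime_hypergraph H \<longleftrightarrow> card (hverts H) \<ge> 3 \<and>
     (\<forall>M. hypergraph_module H M \<longrightarrow> trivial_subset (hverts H) M)"

definition prime_tournament :: "'a pair_pre_digraph \<Rightarrow> bool" where
  "prime_tournament T \<longleftrightarrow> card (pverts T) \<ge> 3 \<and>
     (\<forall>M. tournament_module T M \<longrightarrow> trivial_subset (pverts T) M)"

end

theory Submission
  imports Defs
begin

text \<open>
  A module of \<open>T\<close> is always a module of \<open>C\<^sub>3(T)\<close>. Conversely, let \<open>M\<close> be a nontrivial module of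
  \<open>C\<^sub>3(T)\<close> and let \<open>S\<close> be the set of vertices outside \<open>M\<close> that have both an in-neighbour
  and an out-neighbour in \<open>M\<close>. No 3-cycle contains a vertex of \<open>S\<close>, a vertex of \<open>M\<close> and a third
  vertex outside \<open>M\<close>, so a vertex outside \<open>M \<union> S\<close> dominating (or dominated by) \<open>M\<close> also
  dominates (or is dominated by) \<open>S\<close>: thus \<open>M \<union> S\<close> is a module of \<open>T\<close>. If \<open>T\<close> is
  prime, then \<open>S\<close> is nonempty and \<open>M \<union> S\<close> is the whole vertex set, and no 3-cycle meets both
  \<open>M\<close> and its complement. Hence an arc from \<open>M\<close> to its complement lies on no directed cycle, so
  that \<open>T\<close> is not strongly connected and therefore not prime.
\<close>

context tournament
begin

section \<open>Arcs of a tournament and edges of its C3-structure\<close>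

lemma arc_asym: "(x, y) \<in> parcs G \<Longrightarrow> (y, x) \<notin> parcs G"
  using exactly_one_arc[of x y] pair_no_loops[of "(x, y)"] wellformed'[of x y] by auto

lemma arc_irrefl: "(x, x) \<notin> parcs G"
  using arc_asym by blast

lemma arc_total:
  "\<lbrakk>x \<in> pverts G; y \<in> pverts G; x \<noteq> y\<rbrakk> \<Longrightarrow> (x, y) \<in> parcs G \<or> (y, x) \<in> parcs G"
  using exactly_one_arc by blast

lemma is_3_cycleD:
  assumes "is_3_cycle (with_proj G \<restriction> X)"
  obtains a b c where "X = {a, b, c}" "(a, b) \<in> parcs G" "(b, c) \<in> parcs G" "(c, a) \<in> parcs G"
proof -
  obtain f where iso: "pre_digraph.digraph_isomorphism (with_proj G \<restriction> X) f"
    and app: "with_proj cyclic_triangle = app_iso f (with_proj G \<restriction> X)"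
    using assms unfolding is_3_cycle_def digraph_iso_def by auto
  have img: "iso_verts f ` X = {0, 1, 2}"
    using arg_cong[OF app, of verts] by (simp add: verts_app_iso cyclic_triangle_def)
  have arcs: "iso_arcs f ` {e \<in> parcs G. fst e \<in> X \<and> snd e \<in> X} = {(0, 1), (1, 2), (2, 0)}"
    using arg_cong[OF app, of arcs] by (simp add: arcs_app_iso cyclic_triangle_def)
  \<comment> \<open>\<open>app_iso f\<close> takes its projections from \<open>iso_tail f\<close>
    and \<open>iso_head f\<close>, and the image is a digraph on pairs, so these must be
    \<open>fst\<close> and \<open>snd\<close>.\<close>
  have tail: "iso_tail f = fst" and head: "iso_head f = snd"
    using arg_cong[OF app, of tail] arg_cong[OF app, of head]
    by (simp_all add: tail_app_iso head_app_iso)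
  have inj: "inj_on (iso_verts f) X"
    and ends: "\<And>e. \<lbrakk>e \<in> parcs G; fst e \<in> X; snd e \<in> X\<rbrakk> \<Longrightarrow>
      iso_verts f (fst e) = fst (iso_arcs f e) \<and> iso_verts f (snd e) = snd (iso_arcs f e)"
    using iso by (auto simp: pre_digraph.digraph_isomorphism_def tail head)
  \<comment> \<open>An isomorphism moves arcs by a separate function, so an arc of the triangle only
    yields some preimage \<open>e\<close>; injectivity on vertices identifies the ends of
    \<open>e\<close> with \<open>x\<close> and \<open>y\<close>.\<close>
  have arcI: "(x, y) \<in> parcs G"
    if "x \<in> X" "y \<in> X" "(iso_verts f x, iso_verts f y) \<in> {(0, 1), (1, 2), (2, 0)}" for x y
  proof -
    have "(iso_verts f x, iso_verts f y) \<in> iso_arcs f ` {e \<in> parcs G. fst e \<in> X \<and> snd e \<in> X}"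
      using that(3) arcs by simp
    then obtain e where e: "e \<in> parcs G" "fst e \<in> X" "snd e \<in> X"
      and fe: "iso_arcs f e = (iso_verts f x, iso_verts f y)"
      by auto
    have "fst e = x" "snd e = y"
      using ends[OF e] fe inj e that(1,2) by (auto simp: inj_on_def)
    with e show ?thesis by auto
  qed
  have preimage: "\<exists>x\<in>X. iso_verts f x = i" if "i \<in> {0, 1, 2}" for i
    using that unfolding img[symmetric] by (elim imageE) (rule bexI, rule sym)
  obtain a b c where abc: "a \<in> X" "b \<in> X" "c \<in> X"
    "iso_verts f a = 0" "iso_verts f b = 1" "iso_verts f c = 2"
    using preimage[of 0] preimage[of 1] preimage[of 2] by auto
  have "x \<in> {a, b, c}" if "x \<in> X" for x
  proof -
    have "iso_verts f x \<in> {0, 1, 2}" using that unfolding img[symmetric] by (rule imageI)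
    then have "iso_verts f x = iso_verts f a \<or> iso_verts f x = iso_verts f b \<or>
        iso_verts f x = iso_verts f c"
      using abc(4-6) by simp
    then show ?thesis using inj_on_eq_iff[OF inj that] abc(1-3) by simp
  qed
  with abc have "X = {a, b, c}" by auto
  moreover have "(a, b) \<in> parcs G" "(b, c) \<in> parcs G" "(c, a) \<in> parcs G"
    using abc by (simp_all add: arcI)
  ultimately show thesis by (rule that)
qed

lemma is_3_cycleI:
  assumes "(a, b) \<in> parcs G" "(b, c) \<in> parcs G" "(c, a) \<in> parcs G"
  shows "is_3_cycle (with_proj G \<restriction> {a, b, c})"
proof -
  have dist: "a \<noteq> b" "b \<noteq> c" "c \<noteq> a" using assms arc_irrefl by auto
  \<comment> \<open>Within the triple, the default value 2 is taken by \<open>c\<close>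
    alone.\<close>
  define h :: "'a \<Rightarrow> nat" where "h = (\<lambda>x. if x = a then 0 else if x = b then 1 else 2)"
  define f where
    "f = \<lparr>iso_verts = h, iso_arcs = map_prod h h, iso_head = snd, iso_tail = fst\<rparr>"
  let ?X = "{a, b, c}"
  have hinj: "inj_on h ?X" using dist by (auto simp: inj_on_def h_def)
  have "(x, y) \<in> arcs (with_proj G \<restriction> ?X) \<longleftrightarrow> (x, y) \<in> {(a, b), (b, c), (c, a)}" for x y
    using assms arc_irrefl arc_asym[OF assms(1)] arc_asym[OF assms(2)] arc_asym[OF assms(3)] dist
    by simp metis
  then have arcs: "arcs (with_proj G \<restriction> ?X) = {(a, b), (b, c), (c, a)}"
    by (intro set_eqI) (simp only: split_paired_all simp_thms)
  have "inj_on (map_prod h h) {(a, b), (b, c), (c, a)}"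
    using dist by (simp add: h_def)
  then have "pre_digraph.digraph_isomorphism (with_proj G \<restriction> ?X) f"
    unfolding pre_digraph.digraph_isomorphism_def arcs
    using wellformed_induce_subgraph[of ?X] hinj by (simp add: f_def)
  moreover have "with_proj cyclic_triangle = app_iso f (with_proj G \<restriction> ?X)"
    unfolding app_iso_def arcs
    using dist by (simp add: with_proj_def cyclic_triangle_def f_def h_def insert_commute)
  ultimately show ?thesis unfolding is_3_cycle_def digraph_iso_def by blast
qed

text \<open>The triple is unordered: renaming the vertices of a 3-cycle by an even permutation gives
  the first disjunct, by an odd one the second.\<close>

lemma C3_edge_iff:
  "{a, b, c} \<in> hedges (C3_structure G) \<longleftrightarrow>
     (a, b) \<in> parcs G \<and> (b, c) \<in> parcs G \<and> (c, a) \<in> parcs G \<or>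
     (a, c) \<in> parcs G \<and> (c, b) \<in> parcs G \<and> (b, a) \<in> parcs G" (is "?L \<longleftrightarrow> ?R")
proof
  assume ?L
  then have "is_3_cycle (with_proj G \<restriction> {a, b, c})" and "card {a, b, c} = 3"
    by (auto simp: C3_structure_def nsets_def)
  then obtain x y z where xyz: "{a, b, c} = {x, y, z}"
    "(x, y) \<in> parcs G" "(y, z) \<in> parcs G" "(z, x) \<in> parcs G"
    using is_3_cycleD by metis
  have "a \<noteq> b" "b \<noteq> c" "c \<noteq> a"
    using \<open>card {a, b, c} = 3\<close> by (auto simp: card_insert_if split: if_splits)
  moreover have "a \<in> {x, y, z}" "b \<in> {x, y, z}" "c \<in> {x, y, z}" using xyz(1) by blast+
  ultimately show ?R using xyz(2-4) by auto
next
  have edge: "{x, y, z} \<in> hedges (C3_structure G)"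
    if "(x, y) \<in> parcs G" "(y, z) \<in> parcs G" "(z, x) \<in> parcs G" for x y z
  proof -
    have "x \<noteq> y" "y \<noteq> z" "z \<noteq> x" using that arc_irrefl by auto
    with that show ?thesis
      using is_3_cycleI[OF that] wellformed' by (auto simp: C3_structure_def nsets_def)
  qed
  assume ?R
  then show ?L using edge[of a b c] edge[of a c b] by (auto simp: insert_commute)
qed

lemma C3_edgeE:
  assumes "e \<in> hedges (C3_structure G)"
  obtains a b c where "e = {a, b, c}" "(a, b) \<in> parcs G" "(b, c) \<in> parcs G" "(c, a) \<in> parcs G"
proof -
  have "is_3_cycle (with_proj G \<restriction> e)" using assms by (simp add: C3_structure_def)
  then show thesis using that by (rule is_3_cycleD)
qed

lemma hverts_C3 [simp]: "hverts (C3_structure G) = pverts G"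
  by (simp add: C3_structure_def)

section \<open>From modules of the tournament to modules of the C3-structure\<close>

lemma tournament_module_imp_hypergraph_module:
  assumes "tournament_module G M"
  shows "hypergraph_module (C3_structure G) M"
proof -
  have sub: "M \<subseteq> pverts G"
    and mod: "\<And>x y v. \<lbrakk>x \<in> M; y \<in> M; (x, v) \<in> parcs G; (v, y) \<in> parcs G\<rbrakk> \<Longrightarrow> v \<in> M"
    using assms wellformed' unfolding tournament_module_def by blast+
  have one: "\<exists>m\<in>M. {a, b, c} \<inter> M = {m} \<and>
      (\<forall>n\<in>M. ({a, b, c} - {m}) \<union> {n} \<in> hedges (C3_structure G))"
    if cyc: "(a, b) \<in> parcs G" "(b, c) \<in> parcs G" "(c, a) \<in> parcs G"
      and "a \<in> M" and out: "\<not> {a, b, c} \<subseteq> M" for a b c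
  proof -
    \<comment> \<open>A second vertex of the cycle in \<open>M\<close> would put the third on a path
      between two vertices of \<open>M\<close>, hence in \<open>M\<close>.\<close>
    have bc: "b \<notin> M" "c \<notin> M"
      using mod cyc \<open>a \<in> M\<close> out by blast+
    have "{n, b, c} \<in> hedges (C3_structure G)" if "n \<in> M" for n
    proof -
      have "n \<noteq> b" "n \<noteq> c" using bc that by auto
      \<comment> \<open>Otherwise the path \<open>a\<close>, \<open>b\<close>, \<open>n\<close>
        would force \<open>b\<close> into \<open>M\<close>, or the path \<open>n\<close>,
        \<open>c\<close>, \<open>a\<close> would force \<open>c\<close> into
        \<open>M\<close>.\<close>
      then have "(n, b) \<in> parcs G" "(c, n) \<in> parcs G"
        using mod cyc \<open>a \<in> M\<close> bc that arc_total[of n b] arc_total[of n c] sub wellformed'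
        by blast+
      with cyc show ?thesis by (simp add: C3_edge_iff)
    qed
    moreover have "{a, b, c} - {a} = {b, c}" using cyc arc_irrefl by auto
    ultimately show ?thesis using bc \<open>a \<in> M\<close> by (intro bexI[of _ a]) auto
  qed
  have "\<exists>m\<in>M. e \<inter> M = {m} \<and> (\<forall>n\<in>M. (e - {m}) \<union> {n} \<in> hedges (C3_structure G))"
    if "e \<in> hedges (C3_structure G)" "e \<inter> M \<noteq> {}" "e - M \<noteq> {}" for e
  proof -
    from that(1) obtain a b c where e: "e = {a, b, c}"
      and cyc: "(a, b) \<in> parcs G" "(b, c) \<in> parcs G" "(c, a) \<in> parcs G"
      by (rule C3_edgeE)
    \<comment> \<open>Rotating the cycle brings a vertex of \<open>M\<close> to the front.\<close>
    have rot: "{b, c, a} = e" "{c, a, b} = e" using e by auto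
    have "a \<in> M \<or> b \<in> M \<or> c \<in> M" and out: "\<not> e \<subseteq> M" using that(2,3) e by auto
    then consider "a \<in> M" | "b \<in> M" | "c \<in> M" by blast
    then show ?thesis
    proof cases
      case 1
      then show ?thesis using one[OF cyc] out e by simp
    next
      case 2
      then show ?thesis using one[of b c a] cyc out rot by simp
    next
      case 3
      then show ?thesis using one[of c a b] cyc out rot by simp
    qed
  qed
  with sub show ?thesis by (simp add: hypergraph_module_def)
qed

section \<open>3-cycles crossing the boundary of a module of the C3-structure\<close>

lemma no_C3_meets_module_in_two:
  assumes mod: "hypergraph_module (C3_structure G) M"
    and xyM: "x \<in> M" "y \<in> M" and "v \<notin> M"
    and arcs: "(x, v) \<in> parcs G" "(v, y) \<in> parcs G"
  shows "(y, x) \<notin> parcs G"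
proof
  assume "(y, x) \<in> parcs G"
  with arcs have "{x, v, y} \<in> hedges (C3_structure G)" by (simp add: C3_edge_iff)
  moreover have "{x, v, y} \<inter> M \<noteq> {}" "{x, v, y} - M \<noteq> {}" using xyM \<open>v \<notin> M\<close> by auto
  ultimately obtain m where "{x, v, y} \<inter> M = {m}"
    using mod unfolding hypergraph_module_def by meson
  \<comment> \<open>A crossing edge has a single vertex in \<open>M\<close>, but this one contains
    both \<open>x\<close> and \<open>y\<close>.\<close>
  with xyM have "x = y" by auto
  with \<open>(y, x) \<in> parcs G\<close> show False using arc_irrefl by blast
qed

text \<open>Exchanging \<open>m\<close> for \<open>n\<close> gives another edge, and the arc from
  \<open>v\<close> to \<open>w\<close> fixes the direction of its cycle.\<close>

lemma C3_meets_module_in_one: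
  assumes mod: "hypergraph_module (C3_structure G) M"
    and "m \<in> M" "n \<in> M" and vw: "v \<notin> M" "w \<notin> M"
    and cyc: "(m, v) \<in> parcs G" "(v, w) \<in> parcs G" "(w, m) \<in> parcs G"
  shows "(n, v) \<in> parcs G \<and> (w, n) \<in> parcs G"
proof -
  have "{m, v, w} \<in> hedges (C3_structure G)" using cyc by (simp add: C3_edge_iff)
  moreover have "{m, v, w} \<inter> M \<noteq> {}" "{m, v, w} - M \<noteq> {}" using \<open>m \<in> M\<close> vw by auto
  ultimately obtain k where k: "{m, v, w} \<inter> M = {k}"
    "\<forall>n\<in>M. ({m, v, w} - {k}) \<union> {n} \<in> hedges (C3_structure G)"
    using mod unfolding hypergraph_module_def by meson
  have "k = m" using k(1) \<open>m \<in> M\<close> by auto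
  moreover have "({m, v, w} - {m}) \<union> {n} = {n, v, w}" using vw \<open>m \<in> M\<close> by auto
  ultimately have "{n, v, w} \<in> hedges (C3_structure G)" using k(2) \<open>n \<in> M\<close> by fastforce
  with cyc(2) show ?thesis using arc_asym by (auto simp: C3_edge_iff)
qed

section \<open>Strong connectivity of prime tournaments\<close>

lemma prime_no_dominated_set:
  assumes prime: "prime_tournament G" and "R \<subseteq> pverts G"
    and closed: "\<And>p q. \<lbrakk>p \<in> R; (p, q) \<in> parcs G\<rbrakk> \<Longrightarrow> q \<in> R"
  shows "R = {} \<or> R = pverts G"
proof -
  \<comment> \<open>No path leaves \<open>R\<close> and returns, nor leaves the complement and
    returns, since no arc goes out of \<open>R\<close>.\<close>
  have "tournament_module G R" "tournament_module G (pverts G - R)"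
    using closed \<open>R \<subseteq> pverts G\<close> unfolding tournament_module_def by blast+
  then have triv: "trivial_subset (pverts G) R" "trivial_subset (pverts G) (pverts G - R)"
    and card: "card (pverts G) \<ge> 3"
    using prime unfolding prime_tournament_def by auto
  have "False" if "R \<noteq> {}" "R \<noteq> pverts G"
  proof -
    have "pverts G - R \<noteq> {}" "pverts G - R \<noteq> pverts G"
      using that \<open>R \<subseteq> pverts G\<close> by auto
    with triv that obtain v w where "R = {v}" "pverts G - R = {w}"
      unfolding trivial_subset_def by auto
    then have "pverts G \<subseteq> {v, w}" by auto
    then have "card (pverts G) \<le> card {v, w}" by (intro card_mono) auto
    also have "\<dots> \<le> 2" by (simp add: card_insert_if)
    finally show False using card by simp
  qed
  then show ?thesis by blast
qed

text \<open>A two-arc path that changes sides can be shortened to one arc, as no 3-cycle changes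
  sides. An arc from \<open>m\<close> to \<open>s\<close> would thus give a set closed under
  out-neighbours that contains \<open>s\<close> and omits \<open>m\<close>.\<close>

lemma prime_no_arc_between_C3_closed_parts:
  assumes prime: "prime_tournament G" and V: "pverts G = M \<union> S" and disj: "M \<inter> S = {}"
    and nocyc: "\<And>a b c. \<lbrakk>(a, b) \<in> parcs G; (b, c) \<in> parcs G; (c, a) \<in> parcs G\<rbrakk> \<Longrightarrow>
      (a \<in> M \<longleftrightarrow> b \<in> M) \<and> (b \<in> M \<longleftrightarrow> c \<in> M)"
    and "m \<in> M" "s \<in> S"
  shows "(m, s) \<notin> parcs G"
proof
  assume ms: "(m, s) \<in> parcs G"
  have tr: "(a, c) \<in> parcs G"
    if "(a, b) \<in> parcs G" "(b, c) \<in> parcs G" "(a \<in> M) \<noteq> (b \<in> M) \<or> (b \<in> M) \<noteq> (c \<in> M)" for a b c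
    using that nocyc[of a b c] arc_total[of a c] arc_asym[of a b] wellformed' by blast
  \<comment> \<open>The vertices reachable from an out-neighbour of \<open>m\<close> in \<open>S\<close>.\<close>
  define R where "R = {q \<in> S. (m, q) \<in> parcs G} \<union>
    {q \<in> M. \<exists>t\<in>S. (m, t) \<in> parcs G \<and> (t, q) \<in> parcs G}"
  have "q \<in> R" if "p \<in> R" and pq: "(p, q) \<in> parcs G" for p q
  proof -
    have q: "q \<in> M \<or> q \<in> S" using pq wellformed' V by blast
    show ?thesis
    proof (cases "p \<in> S")
      case True
      then have mp: "(m, p) \<in> parcs G" using \<open>p \<in> R\<close> disj by (auto simp: R_def)
      then have "(m, q) \<in> parcs G" if "q \<in> S"
        using tr[OF mp pq] that True disj \<open>m \<in> M\<close> by blast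
      with q mp pq True show ?thesis by (auto simp: R_def)
    next
      case False
      then obtain t where t: "t \<in> S" "(m, t) \<in> parcs G" "(t, p) \<in> parcs G" and "p \<in> M"
        using \<open>p \<in> R\<close> by (auto simp: R_def)
      have tM: "t \<notin> M" using t disj by blast
      have "(t, q) \<in> parcs G" if "q \<in> M" using tr[OF t(3) pq] tM \<open>p \<in> M\<close> by blast
      moreover have "(m, q) \<in> parcs G" if "q \<in> S"
      proof -
        \<comment> \<open>Shorten the path \<open>m\<close>, \<open>t\<close>, \<open>p\<close>,
          \<open>q\<close> twice: \<open>t\<close> and \<open>p\<close> lie on different sides, and
          so do \<open>p\<close> and \<open>q\<close>.\<close>
        have "(m, p) \<in> parcs G" using tr[OF t(2,3)] tM \<open>m \<in> M\<close> by blast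
        then show ?thesis using tr[OF _ pq] \<open>p \<in> M\<close> that disj by blast
      qed
      ultimately show ?thesis using q t by (auto simp: R_def)
    qed
  qed
  moreover have "R \<subseteq> pverts G" using V by (auto simp: R_def)
  ultimately have "R = {} \<or> R = pverts G" by (intro prime_no_dominated_set[OF prime]) auto
  moreover have "s \<in> R" using ms \<open>s \<in> S\<close> by (simp add: R_def)
  moreover have "m \<notin> R" using disj \<open>m \<in> M\<close> arc_asym by (auto simp: R_def)
  ultimately show False using V \<open>m \<in> M\<close> by blast
qed

section \<open>Modules of the C3-structure of a prime tournament\<close>

lemma prime_imp_hypergraph_module_trivial:
  assumes prime: "prime_tournament G" and mod: "hypergraph_module (C3_structure G) M"
  shows "trivial_subset (pverts G) M"
proof (rule ccontr)
  assume nontriv: "\<not> trivial_subset (pverts G) M"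
  have sub: "M \<subseteq> pverts G" using mod by (simp add: hypergraph_module_def)
  define S where "S = {v \<in> pverts G - M. \<exists>x\<in>M. \<exists>y\<in>M. (x, v) \<in> parcs G \<and> (v, y) \<in> parcs G}"
  have split: "\<exists>x\<in>M. \<exists>y\<in>M. (x, s) \<in> parcs G \<and> (s, y) \<in> parcs G" "s \<notin> M" if "s \<in> S" for s
    using that by (auto simp: S_def)
  \<comment> \<open>All of \<open>M\<close> dominates \<open>v\<close> and is dominated by
    \<open>w\<close>, so neither is split by \<open>M\<close>.\<close>
  have noS: "v \<notin> S \<and> w \<notin> S"
    if cyc: "(m, v) \<in> parcs G" "(v, w) \<in> parcs G" "(w, m) \<in> parcs G"
      and mvw: "m \<in> M" "v \<notin> M" "w \<notin> M" for m v w
  proof -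
    have "(n, v) \<in> parcs G \<and> (w, n) \<in> parcs G" if "n \<in> M" for n
      using C3_meets_module_in_one[OF mod mvw(1) that mvw(2,3) cyc] .
    then show ?thesis using arc_asym by (auto simp: S_def)
  qed
  \<comment> \<open>Since \<open>w\<close> is not in \<open>S\<close>, it dominates all of
    \<open>M\<close>. If \<open>s\<close> dominated \<open>w\<close>, an in-neighbour
    \<open>x\<close> of \<open>s\<close> in \<open>M\<close> would close a 3-cycle excluded by
    \<open>noS\<close>.\<close>
  have out: "(w, s) \<in> parcs G"
    if "s \<in> S" "w \<in> pverts G" "w \<notin> M \<union> S" "m \<in> M" "(w, m) \<in> parcs G" for s w m
  proof (rule ccontr)
    assume "(w, s) \<notin> parcs G"
    have "s \<in> pverts G" "s \<noteq> w" using that by (auto simp: S_def)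
    with \<open>(w, s) \<notin> parcs G\<close> that have sw: "(s, w) \<in> parcs G" using arc_total by blast
    obtain x where x: "x \<in> M" "(x, s) \<in> parcs G" using split[OF \<open>s \<in> S\<close>] by blast
    have "(x, w) \<notin> parcs G" using that x by (auto simp: S_def)
    then have "(w, x) \<in> parcs G" using arc_total[of x w] x that sub by blast
    then show False using noS[OF x(2) sw] x split(2) that by blast
  qed
  \<comment> \<open>The same argument with all arcs reversed.\<close>
  have inn: "(s, w) \<in> parcs G"
    if "s \<in> S" "w \<in> pverts G" "w \<notin> M \<union> S" "m \<in> M" "(m, w) \<in> parcs G" for s w m
  proof (rule ccontr)
    assume "(s, w) \<notin> parcs G"
    have "s \<in> pverts G" "s \<noteq> w" using that by (auto simp: S_def)
    with \<open>(s, w) \<notin> parcs G\<close> that have ws: "(w, s) \<in> parcs G" using arc_total by blast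
    obtain x where x: "x \<in> M" "(s, x) \<in> parcs G" using split[OF \<open>s \<in> S\<close>] by blast
    have "(w, x) \<notin> parcs G" using that x by (auto simp: S_def)
    then have "(x, w) \<in> parcs G" using arc_total[of x w] x that sub by blast
    then show False using noS[OF _ ws x(2)] x split(2) that by blast
  qed
  obtain m0 where "m0 \<in> M" using nontriv by (auto simp: trivial_subset_def)
  have "tournament_module G (M \<union> S)"
    unfolding tournament_module_def
  proof (intro conjI ballI impI)
    show "M \<union> S \<subseteq> pverts G" using sub by (auto simp: S_def)
  next
    fix x y w
    assume xy: "x \<in> M \<union> S" "y \<in> M \<union> S" and w: "w \<in> pverts G"
      and arcs: "(x, w) \<in> parcs G \<and> (w, y) \<in> parcs G"
    show "w \<in> M \<union> S"
    proof (rule ccontr)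
      assume wMS: "w \<notin> M \<union> S"
      then have "w \<noteq> m0" using \<open>m0 \<in> M\<close> by auto
      \<comment> \<open>The direction of the arc between \<open>w\<close> and \<open>m0\<close>
        decides that of the arcs between \<open>w\<close> and all of
        \<open>M \<union> S\<close>.\<close>
      then consider "(w, m0) \<in> parcs G" | "(m0, w) \<in> parcs G"
        using arc_total[of w m0] w \<open>m0 \<in> M\<close> sub by blast
      then show False
      proof cases
        case 1
        then have "x \<notin> S" using out[OF _ w wMS \<open>m0 \<in> M\<close>] arcs arc_asym by blast
        then show False using xy(1) arcs 1 wMS w \<open>m0 \<in> M\<close> by (auto simp: S_def)
      next
        case 2
        then have "y \<notin> S" using inn[OF _ w wMS \<open>m0 \<in> M\<close>] arcs arc_asym by blast
        then show False using xy(2) arcs 2 wMS w \<open>m0 \<in> M\<close> by (auto simp: S_def)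
      qed
    qed
  qed
  then have "trivial_subset (pverts G) (M \<union> S)" using prime by (simp add: prime_tournament_def)
  moreover have "\<not> M \<subseteq> {v}" for v
    using nontriv sub \<open>m0 \<in> M\<close> by (auto simp: trivial_subset_def)
  ultimately have V: "pverts G = M \<union> S"
    using \<open>m0 \<in> M\<close> by (auto simp: trivial_subset_def)
  have "M \<noteq> pverts G" using nontriv by (auto simp: trivial_subset_def)
  then obtain s where "s \<in> S" using V by auto
  have disj: "M \<inter> S = {}" by (auto simp: S_def)
  \<comment> \<open>Two vertices in \<open>M\<close> bring in the third by \<open>two\<close>. If
    exactly one is in \<open>M\<close>, the others lie in \<open>S\<close>, against
    \<open>noS\<close>.\<close>
  have cross: "(a \<in> M \<longleftrightarrow> b \<in> M) \<and> (b \<in> M \<longleftrightarrow> c \<in> M)"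
    if "(a, b) \<in> parcs G" "(b, c) \<in> parcs G" "(c, a) \<in> parcs G" for a b c
  proof -
    have two: "z \<in> M"
      if "x \<in> M" "y \<in> M" "(x, z) \<in> parcs G" "(z, y) \<in> parcs G" "(y, x) \<in> parcs G" for x y z
      using no_C3_meets_module_in_two[OF mod] that by blast
    have one: "y \<in> M \<or> z \<in> M"
      if "x \<in> M" "(x, y) \<in> parcs G" "(y, z) \<in> parcs G" "(z, x) \<in> parcs G" for x y z
    proof (rule ccontr)
      assume "\<not> (y \<in> M \<or> z \<in> M)"
      moreover from this have "y \<in> S" using V that wellformed' by blast
      ultimately show False using noS[OF that(2-4,1)] by blast
    qed
    show ?thesis
      using that two[of a c b] two[of b a c] two[of c b a] one[of a b c] one[of b c a] one[of c a b]
      by blast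
  qed
  obtain m where "m \<in> M" "(m, s) \<in> parcs G" using split[OF \<open>s \<in> S\<close>] by blast
  then show False
    using prime_no_arc_between_C3_closed_parts[OF prime V disj cross \<open>m \<in> M\<close> \<open>s \<in> S\<close>] by blast
qed

theorem prime_C3_structure_iff:
  "prime_hypergraph (C3_structure G) \<longleftrightarrow> prime_tournament G"
proof
  assume "prime_hypergraph (C3_structure G)"
  then show "prime_tournament G"
    using tournament_module_imp_hypergraph_module
    by (simp add: prime_hypergraph_def prime_tournament_def)
next
  assume prime: "prime_tournament G"
  then show "prime_hypergraph (C3_structure G)"
    using prime_imp_hypergraph_module_trivial[OF prime]
    by (simp add: prime_hypergraph_def prime_tournament_def)
qed

end

theorem theorem11:
  fixes H :: "'a hypergraph" and T :: "'a pair_pre_digraph"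
  assumes "three_uniform_hypergraph H"
    and "realizable H"
    and "realization T H"
  shows "prime_hypergraph H \<longleftrightarrow> prime_tournament T"
  using assms(3) tournament.prime_C3_structure_iff by (auto simp: realization_def)

end
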